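(* Let $\mathcal{P}$ be the finite set of possible points of interest (POIs), $\mathcal{L}_t$ the finite set of possible positions at timestep $t$, $\delta\in(0,1]$, $\epsilon>0$, and $\mathcal{L}^*_t\subseteq\mathcal{L}_t$ the $\delta$-obfuscation set used at timestep $t$. Let $\mathcal{M}$ be a mechanism that satisfies $(\epsilon,\delta)$-location privacy on $\mathcal{L}_t$ for any output $z_t$ (the released location) and any adversary knowing that the true location $l^*_t$ is in $\mathcal{L}^*_t$. Then $\mathcal{M}$ satisfies $(\epsilon,\delta,\theta)$-POI privacy for any POI $P\in\mathcal{P}$, that is, for any output $z_t$ and any such adversary, \[ Pr_t^+[P=P^*\mid l^*_t\in\mathcal{L}^*_t]\le \delta^{-1}\cdot e^{\epsilon}\cdot Pr_t^-[P=P^*]+\theta, \] where \[ \theta=(\delta-1)\cdot\min_{l\in\mathcal{L}_t\setminus\mathcal{L}^*_t}Pr[l\leadsto P]. \]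
   Context: Setting. $\mathcal{L}_t$ is the finite set of possible locations of a user at timestep $t$; $l^*_t$ is the (unknown) true location. An adversary is modelled by a prior probability distribution $Pr_t^-$ on $\mathcal{L}_t$, where $Pr_t^-[l=l^*_t]$ is its belief, before the release at timestep $t$, that $l$ is the true location. A mechanism $\mathcal{M}$ is a randomized map that releases an output $z_t$ given the true location, with conditional probability (or density) $Pr[z_t\mid l=l^*_t]$. $\delta$-obfuscation set: a subset $\mathcal{L}^*_t\subseteq\mathcal{L}_t$ with $\sum_{l\in\mathcal{L}^*_t}Pr_t^-[l=l^*_t]=\delta$. It is assumed that $l^*_t\in\mathcal{L}^*_t$ and that the adversary knows $\mathcal{L}^*_t$ and the fact that $l^*_t\in\mathcal{L}^*_t$. "Any adversary" means any prior on $\mathcal{L}_t$ that gives $\mathcal{L}^*_t$ total mass $\delta$. $Pr_t^+[l=l^*_t\mid l^*_t\in\mathcal{L}^*_t]$ denotes the Bayesian posterior of this adversary after observing $z_t$ (of positive probability or density), computed from the prior conditioned on $l^*_t\in\mathcal{L}^*_t$ and the likelihood $Pr[z_t\mid l=l^*_t]$. $(\epsilon,\delta)$-location privacy on $\mathcal{L}_t$: for any output $z_t$, any $l_i\in\mathcal{L}_t$ and any adversary knowing that $l^*_t\in\mathcal{L}^*_t$: $Pr_t^+[l_i=l^*_t\mid l^*_t\in\mathcal{L}^*_t]=0$ if $l_i\notin\mathcal{L}^*_t$, and $Pr_t^+[l_i=l^*_t\mid l^*_t\in\mathcal{L}^*_t]\le\delta^{-1}e^{\epsilon}Pr_t^-[l_i=l^*_t]$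 otherwise. POIs. $P^*$ is the POI visited by the user between the releases $z_{t-1}$ and $z_t$. For $l\in\mathcal{L}_t$ and $P\in\mathcal{P}$, $Pr[l\leadsto P]\in[0,1]$ is the adversary's belief (fixed before the release of $z_t$) that the user visited $P$, given the location $z_{t-1}$ disclosed at timestep $t-1$ and given $l$ as the potential location of the user at timestep $t$. It is not affected by the output of $\mathcal{M}$, and the events $l=l^*_t$ and $l\leadsto P$ are independent. The adversary's belief about the visited POI is obtained by summing over locations: $Pr_t^-[P=P^*]=\sum_{l\in\mathcal{L}_t}Pr_t^-[l=l^*_t]\,Pr[l\leadsto P]$ before the release, and $Pr_t^+[P=P^*\mid l^*_t\in\mathcal{L}^*_t]=\sum_{l\in\mathcal{L}_t}Pr_t^+[l=l^*_t\mid l^*_t\in\mathcal{L}^*_t]\,Pr[l\leadsto P]$ after it. Convention: if $\mathcal{L}_t\setminus\mathcal{L}^*_t=\emptyset$ (so that $\delta=1$), then $\theta=0$. *)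

theory Defs
  imports "HOL-Probability.Probability"
begin

text \<open>
  A mechanism is given by its likelihoods: \<open>k l z\<close> is the conditional density at the output \<open>z\<close>
  given that the true location is \<open>l\<close>, with respect to a reference measure \<open>N\<close> on the outputs.
  For \<open>N = count_space A\<close> it is the conditional probability of releasing \<open>z\<close>.
\<close>

definition mechanism :: "'l set \<Rightarrow> 'z measure \<Rightarrow> ('l \<Rightarrow> 'z \<Rightarrow> real) \<Rightarrow> bool" where
  "mechanism L N k \<longleftrightarrow>
     (\<forall>l\<in>L. k l \<in> borel_measurable N \<and> (\<forall>z\<in>space N. 0 \<le> k l z) \<and>
        prob_space (density N (\<lambda>z. ennreal (k l z))))"

definition obfuscation_set :: "'l set \<Rightarrow> 'l pmf \<Rightarrow> real \<Rightarrow> 'l set \<Rightarrow> bool" where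
  "obfuscation_set L p \<delta> Lstar \<longleftrightarrow> Lstar \<subseteq> L \<and> (\<Sum>l\<in>Lstar. pmf p l) = \<delta>"

text \<open>
  An adversary is identified with its prior \<open>p\<close>.  That it knows that the true location lies in
  \<open>Lstar\<close> is expressed by conditioning the prior on \<open>Lstar\<close> in \<open>evidence\<close> and \<open>posterior\<close> below;
  the conditioning is meaningful when \<open>\<delta> > 0\<close>.
\<close>

definition adversary :: "'l set \<Rightarrow> 'l set \<Rightarrow> real \<Rightarrow> 'l pmf \<Rightarrow> bool" where
  "adversary L Lstar \<delta> p \<longleftrightarrow> set_pmf p \<subseteq> L \<and> obfuscation_set L p \<delta> Lstar"

definition evidence :: "'l set \<Rightarrow> 'l set \<Rightarrow> ('l \<Rightarrow> 'z \<Rightarrow> real) \<Rightarrow> 'l pmf \<Rightarrow> 'z \<Rightarrow> real" where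
  "evidence L Lstar k p z = (\<Sum>l\<in>L. pmf (cond_pmf p Lstar) l * k l z)"

definition posterior :: "'l set \<Rightarrow> 'l set \<Rightarrow> ('l \<Rightarrow> 'z \<Rightarrow> real) \<Rightarrow> 'l pmf \<Rightarrow> 'z \<Rightarrow> 'l \<Rightarrow> real" where
  "posterior L Lstar k p z l = pmf (cond_pmf p Lstar) l * k l z / evidence L Lstar k p z"

definition location_privacy ::
    "'l set \<Rightarrow> 'l set \<Rightarrow> 'z measure \<Rightarrow> ('l \<Rightarrow> 'z \<Rightarrow> real) \<Rightarrow> real \<Rightarrow> real \<Rightarrow> bool" where
  "location_privacy L Lstar N k \<epsilon> \<delta> \<longleftrightarrow>
     (\<forall>p. adversary L Lstar \<delta> p \<longrightarrow>
       (\<forall>z\<in>space N. 0 < evidence L Lstar k p z \<longrightarrow>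
         (\<forall>l\<in>L.
            (l \<notin> Lstar \<longrightarrow> posterior L Lstar k p z l = 0) \<and>
            (l \<in> Lstar \<longrightarrow> posterior L Lstar k p z l \<le> inverse \<delta> * exp \<epsilon> * pmf p l))))"

text \<open>
  \<open>visit l P\<close> is the adversary's belief that \<open>P\<close> was visited, given that \<open>l\<close> is the present
  location and given the previously disclosed location, which is fixed and left implicit.
\<close>

definition poi_prior :: "'l set \<Rightarrow> ('l \<Rightarrow> 'p \<Rightarrow> real) \<Rightarrow> 'l pmf \<Rightarrow> 'p \<Rightarrow> real" where
  "poi_prior L visit p P = (\<Sum>l\<in>L. pmf p l * visit l P)"

definition poi_posterior ::
    "'l set \<Rightarrow> 'l set \<Rightarrow> ('l \<Rightarrow> 'z \<Rightarrow> real) \<Rightarrow> ('l \<Rightarrow> 'p \<Rightarrow> real) \<Rightarrow> 'l pmf \<Rightarrow> 'z \<Rightarrow> 'p \<Rightarrow> real" where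
  "poi_posterior L Lstar k visit p z P = (\<Sum>l\<in>L. posterior L Lstar k p z l * visit l P)"

definition poi_privacy ::
    "'l set \<Rightarrow> 'l set \<Rightarrow> 'z measure \<Rightarrow> ('l \<Rightarrow> 'z \<Rightarrow> real) \<Rightarrow> ('l \<Rightarrow> 'p \<Rightarrow> real)
       \<Rightarrow> real \<Rightarrow> real \<Rightarrow> real \<Rightarrow> 'p \<Rightarrow> bool" where
  "poi_privacy L Lstar N k visit \<epsilon> \<delta> \<theta> P \<longleftrightarrow>
     (\<forall>p. adversary L Lstar \<delta> p \<longrightarrow>
       (\<forall>z\<in>space N. 0 < evidence L Lstar k p z \<longrightarrow>
          poi_posterior L Lstar k visit p z P
            \<le> inverse \<delta> * exp \<epsilon> * poi_prior L visit p P + \<theta>))"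

text \<open>The minimum over the empty set has no meaning; by convention the value is then \<open>0\<close>.\<close>

definition poi_theta :: "'l set \<Rightarrow> 'l set \<Rightarrow> ('l \<Rightarrow> 'p \<Rightarrow> real) \<Rightarrow> real \<Rightarrow> 'p \<Rightarrow> real" where
  "poi_theta L Lstar visit \<delta> P =
     (if L - Lstar = {} then 0 else (\<delta> - 1) * Min ((\<lambda>l. visit l P) ` (L - Lstar)))"

end

(* The bound on the posterior of each location in Lstar sums up to the bound for the part of the
   POI prior carried by Lstar.  The complement carries prior mass 1 - \<delta>, hence accounts for at
   least (1 - \<delta>) * min visit of the POI prior; dropping it from the right-hand side gives \<theta>,
   because the factor exp \<epsilon> / \<delta> is at least 1. *)

theory Submission imports Defs begin

text \<open>Each summand is at least the prior of \<open>l\<close> times the smallest value of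
  \<open>visit\<close> on the complement of \<open>Lstar\<close>, and the priors there add up to
  \<open>1 - \<delta>\<close>. If the complement is empty, both sides are 0 by the convention in
  \<open>poi_theta\<close>.\<close>

lemma poi_prior_outside_ge:
  assumes "finite L" and "adversary L Lstar \<delta> p"
  shows "- poi_theta L Lstar visit \<delta> P \<le> (\<Sum>l\<in>L - Lstar. pmf p l * visit l P)"
proof (cases "L - Lstar = {}")
  case True
  then show ?thesis
    unfolding poi_theta_def True by simp
next
  case False
  let ?m = "Min ((\<lambda>l. visit l P) ` (L - Lstar))"
  have sub: "Lstar \<subseteq> L" and mass: "(\<Sum>l\<in>Lstar. pmf p l) = \<delta>" and supp: "set_pmf p \<subseteq> L"
    using assms(2) by (auto simp: adversary_def obfuscation_set_def)
  \<comment> \<open>The prior is supported in \<open>L\<close>, so its mass on \<open>L\<close> is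
    1, of which \<open>Lstar\<close> takes \<open>\<delta>\<close>.\<close>
  have "(\<Sum>l\<in>L - Lstar. pmf p l) = 1 - \<delta>"
    using sum.subset_diff[OF sub assms(1), of "pmf p"] sum_pmf_eq_1[OF assms(1) supp] mass
    by simp
  then have "(1 - \<delta>) * ?m = (\<Sum>l\<in>L - Lstar. pmf p l * ?m)"
    by (simp flip: sum_distrib_right)
  also have "\<dots> \<le> (\<Sum>l\<in>L - Lstar. pmf p l * visit l P)"
    using assms(1) by (intro sum_mono mult_left_mono Min_le) auto
  finally show ?thesis
    using False by (simp add: poi_theta_def algebra_simps)
qed

text \<open>Location privacy makes the posterior vanish outside \<open>Lstar\<close>, so only
  locations in \<open>Lstar\<close> contribute. There its bound can be multiplied by the nonnegative
  weights \<open>visit l P\<close> and summed.\<close>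

lemma poi_posterior_le:
  assumes "finite L" and "location_privacy L Lstar N k \<epsilon> \<delta>" and "adversary L Lstar \<delta> p"
    and "z \<in> space N" and "0 < evidence L Lstar k p z"
    and visit: "\<And>l. l \<in> L \<Longrightarrow> 0 \<le> visit l P"
  shows "poi_posterior L Lstar k visit p z P
           \<le> inverse \<delta> * exp \<epsilon> * (\<Sum>l\<in>Lstar. pmf p l * visit l P)"
proof -
  have sub: "Lstar \<subseteq> L"
    using assms(3) by (simp add: adversary_def obfuscation_set_def)
  have out: "posterior L Lstar k p z l = 0" if "l \<in> L - Lstar" for l
    using assms(2-5) that unfolding location_privacy_def by blast
  have ins: "posterior L Lstar k p z l \<le> inverse \<delta> * exp \<epsilon> * pmf p l" if "l \<in> Lstar" for l
    using assms(2-5) that sub unfolding location_privacy_def by blast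
  have "poi_posterior L Lstar k visit p z P = (\<Sum>l\<in>Lstar. posterior L Lstar k p z l * visit l P)"
    unfolding poi_posterior_def using out by (intro sum.mono_neutral_right assms(1) sub) auto
  also have "\<dots> \<le> (\<Sum>l\<in>Lstar. (inverse \<delta> * exp \<epsilon> * pmf p l) * visit l P)"
    using sub visit by (intro sum_mono mult_right_mono ins) auto
  finally show ?thesis
    by (simp add: sum_distrib_left mult.assoc)
qed

text \<open>This sign ensures that scaling \<open>- poi_theta\<close> by a factor of at least 1 does
  not decrease it.\<close>

lemma poi_theta_nonpos:
  assumes "finite L" and "\<delta> \<le> 1" and "\<And>l. l \<in> L \<Longrightarrow> 0 \<le> visit l P"
  shows "poi_theta L Lstar visit \<delta> P \<le> 0"
  using assms by (auto simp: poi_theta_def intro!: mult_nonpos_nonneg Min.boundedI)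

theorem theorem5p9:
  fixes Pois :: "'p set"
    and L Lstar :: "'l set"
    and N :: "'z measure"
    and k :: "'l \<Rightarrow> 'z \<Rightarrow> real"
    and visit :: "'l \<Rightarrow> 'p \<Rightarrow> real"
    and \<epsilon> \<delta> :: real
  assumes "finite Pois"
    and "finite L"
    and "0 < \<delta>" and "\<delta> \<le> 1"
    and "0 < \<epsilon>"
    and "Lstar \<subseteq> L"
    and "mechanism L N k"
    and "\<And>l P. l \<in> L \<Longrightarrow> P \<in> Pois \<Longrightarrow> visit l P \<in> {0..1}"
    and "location_privacy L Lstar N k \<epsilon> \<delta>"
  shows "\<forall>P\<in>Pois. poi_privacy L Lstar N k visit \<epsilon> \<delta> (poi_theta L Lstar visit \<delta> P) P"
proof (unfold poi_privacy_def, intro ballI allI impI)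
  fix P p z
  assume P: "P \<in> Pois" and adv: "adversary L Lstar \<delta> p"
    and z: "z \<in> space N" and ev: "0 < evidence L Lstar k p z"
  let ?C = "inverse \<delta> * exp \<epsilon>" and ?\<theta> = "poi_theta L Lstar visit \<delta> P"
  let ?in = "\<Sum>l\<in>Lstar. pmf p l * visit l P" and ?out = "\<Sum>l\<in>L - Lstar. pmf p l * visit l P"
  have visit: "\<And>l. l \<in> L \<Longrightarrow> 0 \<le> visit l P"
    using assms(8) P by auto
  have "1 \<le> ?C"
    using mult_mono[of 1 "inverse \<delta>" 1 "exp \<epsilon>"] assms(3-5) by (simp add: one_le_inverse)
  moreover have "?\<theta> \<le> 0"
    using assms(2,4) visit by (rule poi_theta_nonpos)
  \<comment> \<open>The factor \<open>?C\<close> enters here so that the lower bound on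
    \<open>?out\<close> can be compared with \<open>?C * ?out\<close>, the share of the complement
    in the scaled POI prior.\<close>
  ultimately have "- ?\<theta> \<le> ?C * - ?\<theta>"
    using mult_right_mono[of 1 ?C "- ?\<theta>"] by simp
  also have "\<dots> \<le> ?C * ?out"
    using poi_prior_outside_ge[OF assms(2) adv] assms(3) by (intro mult_left_mono) auto
  \<comment> \<open>Obtained from \<open>- ?\<theta> \<le> ?C * ?out\<close> by adding
    \<open>?C * ?in\<close> to both sides and moving \<open>?\<theta>\<close> to the right.\<close>
  finally have "?C * ?in \<le> ?C * (?out + ?in) + ?\<theta>"
    by (simp add: distrib_left)
  also have "?out + ?in = poi_prior L visit p P"
    unfolding poi_prior_def using assms(2,6) by (rule sum.subset_diff[symmetric, rotated])
  finally have "?C * ?in \<le> ?C * poi_prior L visit p P + ?\<theta>" .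
  moreover have "poi_posterior L Lstar k visit p z P \<le> ?C * ?in"
    using assms(2,9) adv z ev visit by (rule poi_posterior_le)
  ultimately show "poi_posterior L Lstar k visit p z P \<le> ?C * poi_prior L visit p P + ?\<theta>"
    by linarith
qed

end
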